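(* The function $I_\Delta:\mathbb Z^2\to\mathbb Z((q^{1/2}))$ is uniquely characterized by the following properties; that is, $f=I_\Delta$ satisfies both (a) and (b), and any function $f:\mathbb Z^2\to\mathbb Z((q^{1/2}))$ satisfying both (a) and (b) equals $I_\Delta$: (a) $f\in V_+$ and $f(0,0)(0)\ne0$ (the constant term of $f(0,0)\in\mathbb Z[[q]]$ is nonzero); (b) $f$ satisfies the pentagon identity $$f(m_1-e_2,e_1)\,f(m_2-e_1,e_2)=\sum_{e_3\in\mathbb Z}q^{e_3}f(m_1,e_1+e_3)\,f(m_2,e_2+e_3)\,f(m_1+m_2,e_3)$$ for all integers $m_1,m_2,e_1,e_2$.
   Context: $\mathbb Z((q^{1/2}))$ denotes the ring of formal Laurent series in $q^{1/2}$ with integer coefficients. For $m,e\in\mathbb Z$, $$I_\Delta(m,e)=\sum_{n=\max\{0,-e\}}^\infty (-1)^n\frac{q^{\frac12 n(n+1)-(n+\frac12 e)m}}{(q)_n(q)_{n+e}},\qquad (q)_n=\prod_{i=1}^n(1-q^i).$$ $V_+$ is the set of functions $f:\mathbb Z^2\to\mathbb Z((q^{1/2}))$ satisfying, for all integers $m,e$, $$q^{\frac e2}f(m+1,e)+q^{-\frac m2}f(m,e+1)-f(m,e)=0,$$ $$q^{\frac e2}f(m-1,e)+q^{-\frac m2}f(m,e-1)-f(m,e)=0,$$ the parity condition $f(m,e)\in q^{\frac{em}2}\mathbb Z((q))$, and the positivity condition $f(m,e)\in\mathbb Z[[q^{1/2}]]$. Infinite sums are understood to converge in $\mathbb Z((q^{1/2}))$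 (for every $N_0$ only finitely many summands have smallest exponent of $q$ less than $N_0$). *)

theory Defs
  imports
    "HOL-Analysis.Analysis"
    "HOL-Computational_Algebra.Formal_Laurent_Series"
begin

text \<open>
  The ring \<open>\<int>((q\<^sup>1\<^sup>/\<^sup>2))\<close> is the type \<^typ>\<open>int fls\<close>, whose formal variable
  stands for the square root of \<open>q\<close>. Hence \<open>q\<close> is the square of the variable, and the coefficient of
  \<open>q\<close> to the power \<open>k/2\<close> in a series is its \<open>k\<close>-th coefficient \<^term>\<open>\<lambda>s :: int fls. fls_nth s k\<close>.
\<close>

text \<open>\<open>qhalf k\<close> is \<open>q\<close> to the power \<open>k/2\<close>.\<close>

definition qhalf :: "int \<Rightarrow> int fls" where
  "qhalf k = fls_X_intpow k"

definition qpoch :: "nat \<Rightarrow> int fls" where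
  "qpoch n = (\<Prod>i=1..n. (1 - qhalf (2 * int i)))"

text \<open>
  The class \<^class>\<open>inverse\<close> has no instance for \<^typ>\<open>int\<close>, so \<^typ>\<open>int fls\<close> has no division. Since
  \<open>qpoch n\<close> has constant term 1 and no negative powers, its inverse is \<^term>\<open>fls_right_inverse (qpoch n) 1\<close>; see
  \<open>qpoch_mult_inv\<close> below.
\<close>

definition qpoch_inv :: "nat \<Rightarrow> int fls" where
  "qpoch_inv n = fls_right_inverse (qpoch n) 1"

text \<open>
  Infinite sums are taken in the library's metric on formal Laurent series; lemma \<open>has_sum_fls_iff\<close>
  below shows that this is convergence in the sense that for every bound only finitely many summands
  have smaller exponents, with the sum formed coefficientwise. The sum defining \<open>I_Delta\<close>
  always converges (\<open>I_Delta_summable\<close>).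
\<close>

definition I_Delta_term :: "int \<Rightarrow> int \<Rightarrow> int \<Rightarrow> int fls" where
  "I_Delta_term m e n =
     (-1) ^ nat n * qhalf (n * (n + 1) - (2 * n + e) * m) *
       (qpoch_inv (nat n) * qpoch_inv (nat (n + e)))"

definition I_Delta :: "int \<Rightarrow> int \<Rightarrow> int fls" where
  "I_Delta m e = (\<Sum>\<^sub>\<infinity>n\<in>{max 0 (-e)..}. I_Delta_term m e n)"

text \<open>The subring \<open>\<int>((q))\<close> consists of the series obtained by substituting the square of the
  variable, and the subring of power series in the square root of \<open>q\<close> is the image of \<^typ>\<open>int fps\<close>.\<close>

definition laurent_q :: "int fls set" where
  "laurent_q = range (\<lambda>g. fls_compose_power g 2)"

definition power_series_qhalf :: "int fls set" where
  "power_series_qhalf = range fps_to_fls"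

definition V_plus :: "(int \<Rightarrow> int \<Rightarrow> int fls) set" where
  "V_plus = {f. \<forall>m e.
      qhalf e * f (m + 1) e + qhalf (-m) * f m (e + 1) - f m e = 0 \<and>
      qhalf e * f (m - 1) e + qhalf (-m) * f m (e - 1) - f m e = 0 \<and>
      f m e \<in> (\<lambda>g. qhalf (e * m) * g) ` laurent_q \<and>
      f m e \<in> power_series_qhalf}"

text \<open>The identity includes the convergence of its right-hand side.\<close>

definition pentagon_identity :: "(int \<Rightarrow> int \<Rightarrow> int fls) \<Rightarrow> bool" where
  "pentagon_identity f \<longleftrightarrow> (\<forall>m1 m2 e1 e2.
     ((\<lambda>e3. qhalf (2 * e3) * f m1 (e1 + e3) * f m2 (e2 + e3) * f (m1 + m2) e3)
        has_sum (f (m1 - e2) e1 * f (m2 - e1) e2)) UNIV)"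

lemma qhalf_mult: "qhalf k * f = fls_shift (- k) f" "f * qhalf k = fls_shift (- k) f"
  unfolding qhalf_def by (rule fls_X_intpow_times_conv_shift)+

lemma qpoch_mult_inv: "qpoch n * qpoch_inv n = 1"
  and qpoch_inv_power_series: "qpoch_inv n \<in> power_series_qhalf"
proof -
  have nth: "fls_nth (qpoch n) 0 = 1 \<and> (\<forall>k<0. fls_nth (qpoch n) k = 0)"
  proof (induction n)
    case 0
    then show ?case by (simp add: qpoch_def)
  next
    case (Suc n)
    have "qpoch (Suc n) = qpoch n * (1 - qhalf (2 * int (Suc n)))"
      unfolding qpoch_def by simp
    also have "\<dots> = qpoch n - fls_shift (- (2 * int (Suc n))) (qpoch n)"
      by (simp add: right_diff_distrib qhalf_mult)
    finally show ?case using Suc by simp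
  qed
  hence deg: "fls_subdegree (qpoch n) = 0"
    by (intro fls_subdegree_eqI) auto
  show "qpoch n * qpoch_inv n = 1" unfolding qpoch_inv_def
    by (intro fls_right_inverse) (use nth deg in auto)
  show "qpoch_inv n \<in> power_series_qhalf"
    by (simp add: qpoch_inv_def power_series_qhalf_def deg)
qed

lemma dist_fls_less_iff:
  fixes a b :: "'a :: group_add fls"
  shows "dist a b < inverse (2 ^ N) \<longleftrightarrow> (\<forall>k\<le>int N. fls_nth a k = fls_nth b k)"
proof (cases "a = b")
  case False
  let ?d = "fls_subdegree (a - b)"
  have "dist a b < inverse (2 ^ N) \<longleftrightarrow> int N < ?d"
  proof (cases "?d \<ge> 0")
    case True
    have "dist a b = inverse (2 ^ nat ?d)" using True False by (simp add: dist_fls_def)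
    hence "dist a b < inverse (2 ^ N) \<longleftrightarrow> N < nat ?d" by simp
    thus ?thesis by linarith
  next
    case neg: False
    have "dist a b = 2 ^ nat (- ?d)" using neg False by (simp add: dist_fls_def)
    moreover have "(1::real) \<le> 2 ^ nat (- ?d)" "inverse (2 ^ N) \<le> (1::real)"
      by (auto simp: inverse_le_1_iff)
    ultimately have "\<not> dist a b < inverse (2 ^ N)" by linarith
    thus ?thesis using neg by auto
  qed
  also have "\<dots> \<longleftrightarrow> (\<forall>k\<le>int N. fls_nth (a - b) k = 0)"
  proof
    assume R: "\<forall>k\<le>int N. fls_nth (a - b) k = 0"
    have "fls_nth (a - b) ?d \<noteq> 0" using False by (intro nth_fls_subdegree_nonzero) simp
    thus "int N < ?d" using R by (meson not_le)
  next
    assume "int N < ?d"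
    thus "\<forall>k\<le>int N. fls_nth (a - b) k = 0"
      by (intro allI impI fls_eq0_below_subdegree) linarith
  qed
  finally show ?thesis by simp
qed auto

lemma has_sum_fls_iff:
  fixes a :: "'i \<Rightarrow> 'a :: ab_group_add fls"
  shows "(a has_sum S) A \<longleftrightarrow>
    (\<forall>N. finite {i\<in>A. \<exists>k<N. fls_nth (a i) k \<noteq> 0}) \<and>
    (\<forall>k. fls_nth S k = (\<Sum>i | i \<in> A \<and> fls_nth (a i) k \<noteq> 0. fls_nth (a i) k))"
proof -
  have nth_sum: "fls_nth (sum a F) k = (\<Sum>i\<in>F. fls_nth (a i) k)" for F k
    by (induction F rule: infinite_finite_induct) auto
  have "(a has_sum S) A \<longleftrightarrow>
    (\<forall>e>0. \<forall>\<^sub>F F in finite_subsets_at_top A. dist (sum a F) S < e)"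
    by (simp add: has_sum_def tendsto_iff)
  also have "\<dots> \<longleftrightarrow> (\<forall>N. \<forall>\<^sub>F F in finite_subsets_at_top A. dist (sum a F) S < inverse (2 ^ N))"
  proof safe
    fix e :: real assume e: "e > 0"
      and H: "\<forall>N. \<forall>\<^sub>F F in finite_subsets_at_top A. dist (sum a F) S < inverse (2 ^ N)"
    obtain N where "inverse (2 ^ N) < e"
      using real_arch_pow_inv[of e "1/2"] e by (auto simp: power_one_over inverse_eq_divide)
    thus "\<forall>\<^sub>F F in finite_subsets_at_top A. dist (sum a F) S < e"
      using H[rule_format, of N] by (auto elim: eventually_mono)
  qed auto
  also have "\<dots> \<longleftrightarrow> (\<forall>N. \<exists>X. finite X \<and> X \<subseteq> A \<and> (\<forall>F. finite F \<and> X \<subseteq> F \<and> F \<subseteq> A \<longrightarrow>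
       (\<forall>k\<le>int N. (\<Sum>i\<in>F. fls_nth (a i) k) = fls_nth S k)))"
    by (simp add: eventually_finite_subsets_at_top dist_fls_less_iff nth_sum)
  also have "\<dots> \<longleftrightarrow> (\<forall>N. finite {i\<in>A. \<exists>k<N. fls_nth (a i) k \<noteq> 0}) \<and>
    (\<forall>k. fls_nth S k = (\<Sum>i | i \<in> A \<and> fls_nth (a i) k \<noteq> 0. fls_nth (a i) k))"
    (is "?L \<longleftrightarrow> ?R")
  proof
    assume L: ?L
    have key: "\<exists>X. finite X \<and> X \<subseteq> A \<and> (\<forall>i\<in>A - X. \<forall>k\<le>int N. fls_nth (a i) k = 0) \<and>
        (\<forall>k\<le>int N. (\<Sum>i\<in>X. fls_nth (a i) k) = fls_nth S k)" for N
    proof -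
      obtain X where X: "finite X" "X \<subseteq> A" and
        XF: "\<And>F k. finite F \<Longrightarrow> X \<subseteq> F \<Longrightarrow> F \<subseteq> A \<Longrightarrow> k \<le> int N \<Longrightarrow>
          (\<Sum>i\<in>F. fls_nth (a i) k) = fls_nth S k"
        using L by metis
      have "fls_nth (a i) k = 0" if "i \<in> A - X" "k \<le> int N" for i k
      proof -
        have "(\<Sum>j\<in>insert i X. fls_nth (a j) k) = fls_nth S k"
          using X that by (intro XF) auto
        moreover have "(\<Sum>j\<in>X. fls_nth (a j) k) = fls_nth S k"
          using X that by (intro XF) auto
        ultimately show ?thesis using X that by simp
      qed
      thus ?thesis using X XF[of X] by blast
    qed
    show ?R
    proof (intro conjI allI)
      fix N :: int
      obtain X where X: "finite X" "\<forall>i\<in>A - X. \<forall>k\<le>int (nat N). fls_nth (a i) k = 0"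
        using key[of "nat N"] by blast
      have "{i\<in>A. \<exists>k<N. fls_nth (a i) k \<noteq> 0} \<subseteq> X"
      proof safe
        fix i k assume "i \<in> A" "k < N" "fls_nth (a i) k \<noteq> 0"
        moreover have "k \<le> int (nat N)" using \<open>k < N\<close> by linarith
        ultimately show "i \<in> X" using X(2) by blast
      qed
      thus "finite {i\<in>A. \<exists>k<N. fls_nth (a i) k \<noteq> 0}" using X(1) finite_subset by blast
    next
      fix k :: int
      obtain X where X: "finite X" "X \<subseteq> A" "\<forall>i\<in>A - X. \<forall>k'\<le>int (nat k). fls_nth (a i) k' = 0"
        "\<forall>k'\<le>int (nat k). (\<Sum>i\<in>X. fls_nth (a i) k') = fls_nth S k'"
        using key[of "nat k"] by blast
      have k: "k \<le> int (nat k)" by simp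
      have "(\<Sum>i\<in>X. fls_nth (a i) k) = (\<Sum>i | i \<in> A \<and> fls_nth (a i) k \<noteq> 0. fls_nth (a i) k)"
        using X k by (intro sum.mono_neutral_right) auto
      thus "fls_nth S k = (\<Sum>i | i \<in> A \<and> fls_nth (a i) k \<noteq> 0. fls_nth (a i) k)"
        using X(4) k by simp
    qed
  next
    assume R: ?R
    show ?L
    proof
      fix N :: nat
      let ?X = "{i\<in>A. \<exists>k<int N + 1. fls_nth (a i) k \<noteq> 0}"
      have "(\<Sum>i\<in>F. fls_nth (a i) k) = fls_nth S k"
        if "finite F" "?X \<subseteq> F" "F \<subseteq> A" "k \<le> int N" for F k
      proof -
        have "(\<Sum>i\<in>F. fls_nth (a i) k) = (\<Sum>i | i \<in> A \<and> fls_nth (a i) k \<noteq> 0. fls_nth (a i) k)"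
          using that by (intro sum.mono_neutral_right) (auto intro: zle_add1_eq_le[THEN iffD2])
        thus ?thesis using R by simp
      qed
      moreover have "finite ?X" using R by blast
      ultimately show "\<exists>X. finite X \<and> X \<subseteq> A \<and> (\<forall>F. finite F \<and> X \<subseteq> F \<and> F \<subseteq> A \<longrightarrow>
       (\<forall>k\<le>int N. (\<Sum>i\<in>F. fls_nth (a i) k) = fls_nth S k))"
        by (intro exI[of _ ?X]) blast
    qed
  qed
  finally show ?thesis .
qed

lemma I_Delta_term_nth_eq_0:
  assumes "k < n * (n + 1) - (2 * n + e) * m"
  shows "fls_nth (I_Delta_term m e n) k = 0"
proof -
  obtain P Q where PQ: "qpoch_inv (nat n) = fps_to_fls P" "qpoch_inv (nat (n + e)) = fps_to_fls Q"
    using qpoch_inv_power_series unfolding power_series_qhalf_def by blast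
  have "qpoch_inv (nat n) * qpoch_inv (nat (n + e)) = fps_to_fls (P * Q)"
    unfolding PQ by (simp add: fls_times_fps_to_fls)
  hence *: "fls_nth (qhalf (n * (n + 1) - (2 * n + e) * m) *
      (qpoch_inv (nat n) * qpoch_inv (nat (n + e)))) k = 0" (is "fls_nth ?T k = 0")
    using assms by (simp add: qhalf_mult)
  have "I_Delta_term m e n = ?T \<or> I_Delta_term m e n = - ?T"
    unfolding I_Delta_term_def by (cases "even (nat n)") (auto simp: mult.assoc)
  thus ?thesis using * by auto
qed

lemma summable_fls_iff:
  fixes a :: "'i \<Rightarrow> 'a :: ab_group_add fls"
  shows "a summable_on A \<longleftrightarrow> (\<forall>N. finite {i\<in>A. \<exists>k<N. fls_nth (a i) k \<noteq> 0})"
proof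
  assume R: "\<forall>N. finite {i\<in>A. \<exists>k<N. fls_nth (a i) k \<noteq> 0}"
  let ?c = "\<lambda>k. \<Sum>i | i \<in> A \<and> fls_nth (a i) k \<noteq> 0. fls_nth (a i) k"
  let ?X = "{i\<in>A. \<exists>k<0. fls_nth (a i) k \<noteq> 0}"
  define M where "M = Min (insert 0 ((\<lambda>i. fls_subdegree (a i)) ` ?X))"
  have fin: "finite (insert 0 ((\<lambda>i. fls_subdegree (a i)) ` ?X))" using R by simp
  have "?c k = 0" if "k < M" for k
  proof -
    have "M \<le> 0" unfolding M_def using fin by (intro Min_le) auto
    have "fls_nth (a i) k = 0" if i: "i \<in> A" for i
    proof (cases "i \<in> ?X")
      case True
      hence "M \<le> fls_subdegree (a i)" unfolding M_def using fin by (intro Min_le) auto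
      thus ?thesis using \<open>k < M\<close> by simp
    next
      case False
      thus ?thesis using i \<open>k < M\<close> \<open>M \<le> 0\<close> by auto
    qed
    thus ?thesis by (intro sum.neutral) auto
  qed
  hence "fls_nth (Abs_fls ?c) k = ?c k" for k
    by (intro nth_Abs_fls_lower_bound[where N = M]) auto
  hence "(a has_sum Abs_fls ?c) A"
    unfolding has_sum_fls_iff using R by simp
  thus "a summable_on A" by (auto simp: summable_on_def)
qed (simp add: summable_on_def has_sum_fls_iff)

lemma I_Delta_summable: "I_Delta_term m e summable_on {max 0 (-e)..}"
  unfolding summable_fls_iff
proof
  fix N :: int
  have "{n \<in> {max 0 (-e)..}. \<exists>k<N. fls_nth (I_Delta_term m e n) k \<noteq> 0} \<subseteq>
      {0..2 * \<bar>m\<bar> + \<bar>N + e * m\<bar>}"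
  proof
    fix n assume "n \<in> {n \<in> {max 0 (-e)..}. \<exists>k<N. fls_nth (I_Delta_term m e n) k \<noteq> 0}"
    then obtain k where k: "0 \<le> n" "k < N" "fls_nth (I_Delta_term m e n) k \<noteq> 0" by auto
    have "n * (n + 1) - (2 * n + e) * m < N"
      using I_Delta_term_nth_eq_0[of k n e m] k by force
    hence less: "n * (n + 1 - 2 * m) < N + e * m" by (simp add: algebra_simps)
    have "n \<le> 2 * \<bar>m\<bar> + \<bar>N + e * m\<bar>"
    proof (rule ccontr)
      assume "\<not> ?thesis"
      hence n: "n > 2 * \<bar>m\<bar> + \<bar>N + e * m\<bar>" by simp
      hence "n * 1 \<le> n * (n + 1 - 2 * m)" using k(1) by (intro mult_left_mono) auto
      thus False using less n by linarith
    qed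
    thus "n \<in> {0..2 * \<bar>m\<bar> + \<bar>N + e * m\<bar>}" using k(1) by simp
  qed
  thus "finite {n \<in> {max 0 (-e)..}. \<exists>k<N. fls_nth (I_Delta_term m e n) k \<noteq> 0}"
    using finite_subset by blast
qed

end

theory Submission
  imports Defs
begin

text \<open>
  The relations defining \<^const>\<open>V_plus\<close> form a rank 2 system of linear \<open>q\<close>-difference equations. A
  solution is determined by its values on the line \<open>m = 0\<close>, where the system reduces to
  \<open>f(0, e + 1) + f(0, e - 1) = (2 - q\<^sup>e) f(0, e)\<close>.
  For \<open>e \<rightarrow> -\<infinity>\<close> the coefficient \<open>q\<^sup>e\<close> has a pole of growing order, so a solution whose values stay
  power series must tend to 0 there. The Wronskian of two such solutions is constant and tends
  to 0, so it is 0 and the solutions are proportional (\<open>bounded_solutions_proportional\<close>). Everything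
  else rests on this rigidity.

  \<^item> Uniqueness. If \<open>f\<close> has the properties (a) and (b), it is proportional to \<^const>\<open>I_Delta\<close>.
    The pentagon identity is quadratic on the left and cubic on the right, so the ratio of
    \<open>f\<close> to \<^const>\<open>I_Delta\<close> is 1 (\<open>pentagon_solution_scale\<close>).

  \<^item> Positivity of \<^const>\<open>I_Delta\<close>. For \<open>m \<le> 0\<close> all summands are power series. The relations are
    invariant, up to powers of \<open>-q\<^sup>1\<^sup>/\<^sup>2\<close>, under a rotation of order 3 of the \<open>(m, e)\<close>-plane; by
    rigidity so is \<^const>\<open>I_Delta\<close> (\<open>I_Delta_triality\<close>), and the rotation moves the other points into the
    half-plane \<open>m \<le> 0\<close>.

  \<^item> The pentagon identity. With \<open>m1 = a + e2\<close> and \<open>m2 = b + e1\<close>, the sum satisfies the relations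
    in \<open>(a, e1)\<close>, by a telescoping argument (\<open>pentagon_summand_telescoping\<close>), and is bounded as
    required. So it is proportional to \<open>I_Delta a e1\<close>, by symmetry also to \<open>I_Delta b e2\<close>, hence to
    their product. The constant of proportionality is 1, because all three quantities tend to 1 for
    \<open>e1 = e2 = 0\<close> and \<open>a = b \<rightarrow> -\<infinity>\<close> (\<open>pentagon_sum_0\<close>).
\<close>

section \<open>Series of large order\<close>

text \<open>All estimates are lower bounds for the order of a series. The zero series satisfies every such
bound, which is why the bound is a predicate and not an inequality for \<^const>\<open>fls_subdegree\<close>,
which is 0 at the zero series.\<close>

definition vanishes_below :: "int \<Rightarrow> 'a::zero fls \<Rightarrow> bool" where
  "vanishes_below d s \<longleftrightarrow> (\<forall>k<d. fls_nth s k = 0)"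

lemma vanishes_below_0 [simp]: "vanishes_below d 0"
  by (simp add: vanishes_below_def)

lemma vanishes_below_mono: "vanishes_below d s \<Longrightarrow> c \<le> d \<Longrightarrow> vanishes_below c s"
  by (auto simp: vanishes_below_def)

lemma vanishes_below_add:
  "vanishes_below d s \<Longrightarrow> vanishes_below d t \<Longrightarrow> vanishes_below d (s + t)"
  by (simp add: vanishes_below_def)

lemma vanishes_below_diff:
  fixes s t :: "'a::group_add fls"
  shows "vanishes_below d s \<Longrightarrow> vanishes_below d t \<Longrightarrow> vanishes_below d (s - t)"
  by (simp add: vanishes_below_def)

lemma vanishes_below_uminus:
  fixes s :: "'a::group_add fls"
  shows "vanishes_below d s \<Longrightarrow> vanishes_below d (- s)"
  by (simp add: vanishes_below_def)

lemma vanishes_below_mult: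
  fixes s t :: "'a::semiring_0 fls"
  assumes "vanishes_below c s" "vanishes_below d t"
  shows "vanishes_below (c + d) (s * t)"
proof (cases "s = 0 \<or> t = 0")
  case False
  hence "c \<le> fls_subdegree s" "d \<le> fls_subdegree t"
    using assms by (auto intro!: fls_subdegree_geI simp: vanishes_below_def)
  thus ?thesis by (auto simp: vanishes_below_def intro!: fls_times_nth_eq0)
qed auto

lemma vanishes_below_qhalf_mult [simp]:
  "vanishes_below d (qhalf k * s) \<longleftrightarrow> vanishes_below (d - k) s"
proof
  assume *: "vanishes_below d (qhalf k * s)"
  have "fls_nth s j = 0" if "j < d - k" for j
    using *[unfolded vanishes_below_def, rule_format, of "j + k"] that by (simp add: qhalf_mult)
  thus "vanishes_below (d - k) s" by (simp add: vanishes_below_def)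
qed (simp add: vanishes_below_def qhalf_mult)

lemma power_series_iff_vanishes_below_0: "s \<in> power_series_qhalf \<longleftrightarrow> vanishes_below 0 s"
proof
  assume "vanishes_below 0 s"
  hence "fls_subdegree s \<ge> 0"
    by (intro fls_subdegree_ge0I) (auto simp: vanishes_below_def)
  thus "s \<in> power_series_qhalf"
    unfolding power_series_qhalf_def by (metis fls_regpart_to_fls_trivial rangeI)
qed (auto simp: power_series_qhalf_def vanishes_below_def)

lemma eq_0_if_vanishes_below_all: "(\<And>d. vanishes_below d s) \<Longrightarrow> s = 0"
  by (intro fls_eqI) (auto simp: vanishes_below_def intro: zless_add1_eq[THEN iffD2])

lemma vanishes_below_exists: "\<exists>d. vanishes_below d s"
  by (auto simp: vanishes_below_def intro: exI[of _ "fls_subdegree s"])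

section \<open>Laurent series as a topological ring\<close>

text \<open>The series congruent to \<open>a\<close> modulo the powers of the variable form a neighbourhood basis of \<open>a\<close>,
so limits can be computed with orders alone.\<close>

lemma eventually_nhds_fls_iff:
  fixes a :: "'a::group_add fls"
  shows "eventually P (nhds a) \<longleftrightarrow> (\<exists>d. \<forall>x. vanishes_below d (x - a) \<longrightarrow> P x)"
proof
  assume "eventually P (nhds a)"
  then obtain e where e: "e > 0" "\<And>x. dist x a < e \<Longrightarrow> P x"
    by (auto simp: eventually_nhds_metric)
  then obtain N where N: "inverse (2 ^ N) < e"
    using real_arch_pow_inv[of e "1/2"] by (auto simp: power_one_over inverse_eq_divide)
  have "P x" if "vanishes_below (int N + 1) (x - a)" for x
  proof (rule e(2))
    have "dist x a < inverse (2 ^ N)"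
      using that unfolding dist_fls_less_iff by (simp add: vanishes_below_def)
    thus "dist x a < e" using N by simp
  qed
  thus "\<exists>d. \<forall>x. vanishes_below d (x - a) \<longrightarrow> P x" by blast
next
  assume "\<exists>d. \<forall>x. vanishes_below d (x - a) \<longrightarrow> P x"
  then obtain d where d: "\<And>x. vanishes_below d (x - a) \<Longrightarrow> P x" by blast
  have "P x" if "dist x a < inverse (2 ^ nat d)" for x
    using that unfolding dist_fls_less_iff by (intro d) (auto simp: vanishes_below_def)
  thus "eventually P (nhds a)"
    unfolding eventually_nhds_metric by (intro exI[of _ "inverse (2 ^ nat d)"]) auto
qed

lemma tendsto_fls_iff:
  fixes a :: "'a::group_add fls"
  shows "(f \<longlongrightarrow> a) F \<longleftrightarrow> (\<forall>d. eventually (\<lambda>x. vanishes_below d (f x - a)) F)"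
proof
  assume *: "(f \<longlongrightarrow> a) F"
  show "\<forall>d. eventually (\<lambda>x. vanishes_below d (f x - a)) F"
  proof
    fix d
    have "eventually (\<lambda>y. vanishes_below d (y - a)) (nhds a)"
      unfolding eventually_nhds_fls_iff by blast
    from *[unfolded filterlim_iff, rule_format, OF this]
    show "eventually (\<lambda>x. vanishes_below d (f x - a)) F" .
  qed
next
  assume *: "\<forall>d. eventually (\<lambda>x. vanishes_below d (f x - a)) F"
  show "(f \<longlongrightarrow> a) F"
    unfolding filterlim_iff
  proof (intro allI impI)
    fix P assume "eventually P (nhds a)"
    then obtain d where "\<And>x. vanishes_below d (x - a) \<Longrightarrow> P x"
      unfolding eventually_nhds_fls_iff by blast
    thus "eventually (\<lambda>x. P (f x)) F"
      using *[rule_format, of d] by (auto elim: eventually_mono)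
  qed
qed

lemma eventually_vanishes_below_nhds:
  fixes a :: "'a::group_add fls"
  shows "eventually (\<lambda>x. vanishes_below d (x - a)) (nhds a)"
  unfolding eventually_nhds_fls_iff by blast

text \<open>With continuous addition and multiplication, the sums that define \<^const>\<open>I_Delta\<close> and the
pentagon sum can be combined linearly by the general rules for \<^const>\<open>has_sum\<close>.\<close>

instance fls :: (ab_group_add) topological_ab_group_add
proof
  fix a b :: "'a fls"
  show "((\<lambda>x. fst x + snd x) \<longlongrightarrow> a + b) (nhds a \<times>\<^sub>F nhds b)"
    unfolding tendsto_fls_iff
  proof
    fix d
    show "eventually (\<lambda>x. vanishes_below d (fst x + snd x - (a + b))) (nhds a \<times>\<^sub>F nhds b)"
      unfolding eventually_prod_filter
      using eventually_vanishes_below_nhds[of d a] eventually_vanishes_below_nhds[of d b]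
      by (intro exI conjI) (assumption+, auto simp: vanishes_below_def)
  qed
  show "(uminus \<longlongrightarrow> - a) (nhds a)"
    unfolding tendsto_fls_iff
  proof
    fix d
    show "eventually (\<lambda>x. vanishes_below d (- x - (- a))) (nhds a)"
      using eventually_vanishes_below_nhds[of d a]
      by eventually_elim (auto simp: vanishes_below_def)
  qed
qed

instance fls :: (comm_ring_1) topological_semigroup_mult
proof
  fix a b :: "'a fls"
  show "((\<lambda>x. fst x * snd x) \<longlongrightarrow> a * b) (nhds a \<times>\<^sub>F nhds b)"
    unfolding tendsto_fls_iff
  proof
    fix d
    obtain v w where vw: "vanishes_below v a" "vanishes_below w b"
      using vanishes_below_exists by blast
    define e where "e = \<bar>d\<bar> + \<bar>v\<bar> + \<bar>w\<bar>"
    have *: "vanishes_below d (x * y - a * b)"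
      if "vanishes_below e (x - a)" "vanishes_below e (y - b)" for x y
    proof -
      have "x * y - a * b = (x - a) * (y - b) + (x - a) * b + a * (y - b)"
        by (simp add: algebra_simps)
      moreover have "vanishes_below d ((x - a) * (y - b))" "vanishes_below d ((x - a) * b)"
        "vanishes_below d (a * (y - b))"
        by (rule vanishes_below_mono, rule vanishes_below_mult, (rule that vw)+, simp add: e_def)+
      ultimately show ?thesis by (simp add: vanishes_below_add)
    qed
    show "eventually (\<lambda>x. vanishes_below d (fst x * snd x - a * b)) (nhds a \<times>\<^sub>F nhds b)"
      unfolding eventually_prod_filter
      using eventually_vanishes_below_nhds[of e a] eventually_vanishes_below_nhds[of e b]
      by (intro exI conjI) (assumption+, auto intro: *)
  qed
qed

lemma summable_fls_cofinite:
  fixes a :: "'i \<Rightarrow> 'a::ab_group_add fls"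
  shows "a summable_on A \<longleftrightarrow> (\<forall>d. finite {i\<in>A. \<not> vanishes_below d (a i)})"
  by (simp add: summable_fls_iff vanishes_below_def)

text \<open>Isolating one summand gives the leading terms of a sum whose other summands have large order.\<close>

lemma vanishes_below_has_sum_remainder:
  fixes a :: "'i \<Rightarrow> 'a::ab_group_add fls"
  assumes "(a has_sum S) A" "i \<in> A" "\<And>j. j \<in> A \<Longrightarrow> j \<noteq> i \<Longrightarrow> vanishes_below d (a j)"
  shows "vanishes_below d (S - a i)"
  unfolding vanishes_below_def
proof (intro allI impI)
  fix k assume k: "k < d"
  have "fls_nth S k = (\<Sum>j | j \<in> A \<and> fls_nth (a j) k \<noteq> 0. fls_nth (a j) k)"
    using assms(1) by (simp add: has_sum_fls_iff)
  also have "\<dots> = (\<Sum>j\<in>{i}. fls_nth (a j) k)"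
    by (rule sum.mono_neutral_left) (use assms(2,3) k in \<open>auto simp: vanishes_below_def\<close>)
  finally show "fls_nth (S - a i) k = 0" by simp
qed

lemma vanishes_below_has_sum:
  fixes a :: "'i \<Rightarrow> 'a::ab_group_add fls"
  assumes "(a has_sum S) A" "\<And>j. j \<in> A \<Longrightarrow> vanishes_below d (a j)"
  shows "vanishes_below d S"
  unfolding vanishes_below_def
proof (intro allI impI)
  fix k assume k: "k < d"
  have "fls_nth S k = (\<Sum>j | j \<in> A \<and> fls_nth (a j) k \<noteq> 0. fls_nth (a j) k)"
    using assms(1) by (simp add: has_sum_fls_iff)
  also have "\<dots> = 0"
    by (rule sum.neutral) (use assms(2) k in \<open>auto simp: vanishes_below_def\<close>)
  finally show "fls_nth S k = 0" .
qed

lemma has_sum_shift_int: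
  fixes a :: "int \<Rightarrow> 'a::{comm_monoid_add,topological_space}"
  shows "((\<lambda>n. a (n + c)) has_sum S) UNIV \<longleftrightarrow> (a has_sum S) UNIV"
  by (rule has_sum_reindex_bij_witness[where i = "\<lambda>n. n - c" and j = "\<lambda>n. n + c"]) auto

section \<open>The contiguity relations and their bounded solutions\<close>

lemma qhalf_add: "qhalf (a + b) = qhalf a * qhalf b"
  by (simp add: qhalf_def fls_X_intpow_times_fls_X_intpow)

lemma qhalf_0 [simp]: "qhalf 0 = 1"
  by (simp add: qhalf_def)

lemma qhalf_nonzero [simp]: "qhalf k \<noteq> 0"
  by (simp add: qhalf_def)

text \<open>The two linear relations defining \<^const>\<open>V_plus\<close> are one relation with \<open>\<sigma> = 1\<close> and with \<open>\<sigma> = -1\<close>.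
The sign is kept as a parameter so that both are verified by the same computation.\<close>

definition solves_recurrences :: "(int \<Rightarrow> int \<Rightarrow> int fls) \<Rightarrow> bool" where
  "solves_recurrences f \<longleftrightarrow> (\<forall>\<sigma>\<in>{1, -1}. \<forall>m e.
     qhalf e * f (m + \<sigma>) e + qhalf (-m) * f m (e + \<sigma>) = f m e)"

lemma solves_recurrences_step:
  assumes "solves_recurrences f" "\<sigma> \<in> {1, -1}"
  shows "qhalf e * f (m + \<sigma>) e = f m e - qhalf (-m) * f m (e + \<sigma>)"
  using assms unfolding solves_recurrences_def eq_diff_eq by blast

lemmas solves_recurrences_up = solves_recurrences_step[where \<sigma> = 1, simplified]
  and solves_recurrences_down = solves_recurrences_step[where \<sigma> = "-1", simplified]

text \<open>On the line \<open>m = 0\<close> the values at \<open>m = 1\<close> can be eliminated between the two relations.\<close>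

lemma three_term_recurrence:
  assumes "solves_recurrences f"
  shows "f 0 (e + 1) + f 0 (e - 1) = 2 * f 0 e - qhalf (2 * e) * f 0 e"
proof -
  note up = solves_recurrences_up[OF assms]
  have 1: "qhalf e * f 1 e = f 0 e - f 0 (e + 1)"
    using up[of e 0] by simp
  have 2: "qhalf (e - 1) * f 1 (e - 1) = f 0 (e - 1) - f 0 e"
    using up[of "e - 1" 0] by simp
  have 3: "qhalf e * f 0 e = f 1 e - qhalf (-1) * f 1 (e - 1)"
    using solves_recurrences_down[OF assms, of e 1] by simp
  have "qhalf (2 * e) * f 0 e = qhalf e * (qhalf e * f 0 e)"
    by (simp only: mult_2 qhalf_add mult.assoc)
  also have "\<dots> = qhalf e * f 1 e - qhalf (e - 1) * f 1 (e - 1)"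
    unfolding 3 by (simp add: algebra_simps flip: qhalf_add)
  finally show ?thesis unfolding 1 2 by simp
qed

text \<open>The three-term recurrence has leading coefficients 1, so it propagates zeros along \<open>m = 0\<close> in both
directions; each contiguity relation then determines one neighbouring line, as powers of \<open>q\<close> are
not zero divisors.\<close>

lemma solution_0_if_Cauchy_data_0:
  assumes h: "solves_recurrences h" and "h 0 0 = 0" "h 0 1 = 0"
  shows "h m e = 0"
proof -
  note rec = three_term_recurrence[OF h]
  have "h 0 e = 0 \<and> h 0 (e + 1) = 0" for e
  proof (induction e rule: int_induct[where k = 0])
    case base
    thus ?case using assms by simp
  next
    case (step1 i)
    thus ?case using rec[of "i + 1"] by simp
  next
    case (step2 i)
    thus ?case using rec[of i] by simp
  qed
  hence 0: "h 0 e = 0" for e by blast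
  have "\<forall>e. h m e = 0"
  proof (induction m rule: int_induct[where k = 0])
    case base
    thus ?case using 0 by simp
  next
    case (step1 i)
    thus ?case using solves_recurrences_up[OF h, of _ i] by simp
  next
    case (step2 i)
    thus ?case using solves_recurrences_down[OF h, of _ i] by simp
  qed
  thus ?thesis by blast
qed

text \<open>The solution space has rank 2, but it contains essentially one solution that is bounded as
\<open>e \<rightarrow> -\<infinity>\<close> on the line \<open>m = 0\<close>. In the three-term recurrence the coefficient \<open>q\<^sup>e\<close> then has large
negative order, so a bounded solution is forced to tend to 0 there. The Wronskian of two bounded
solutions therefore tends to 0; but it does not depend on \<open>e\<close>, because the outer coefficients of the
recurrence are 1. Hence it vanishes, and the solutions are proportional. This rigidity
is the source of all identities below: two expressions agree as soon as both solve the relations,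
both are bounded on such a half-line, and they have the same nonzero value at the origin.\<close>

lemma bounded_solutions_proportional:
  assumes f: "solves_recurrences f" and g: "solves_recurrences g"
    and f_ge: "\<And>e. e \<le> E \<Longrightarrow> vanishes_below 0 (f 0 e)"
    and g_ge: "\<And>e. e \<le> E \<Longrightarrow> vanishes_below 0 (g 0 e)"
  shows "f 0 0 * g m e = g 0 0 * f m e"
proof -
  define W where "W e = f 0 (e + 1) * g 0 e - f 0 e * g 0 (e + 1)" for e
  have "W e = W (e - 1)" for e
  proof -
    have succ: "f 0 (e + 1) = 2 * f 0 e - qhalf (2 * e) * f 0 e - f 0 (e - 1)"
      "g 0 (e + 1) = 2 * g 0 e - qhalf (2 * e) * g 0 e - g 0 (e - 1)"
      using three_term_recurrence[OF f, of e] three_term_recurrence[OF g, of e]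
      by (simp_all add: algebra_simps)
    show ?thesis unfolding W_def succ by (simp add: algebra_simps)
  qed
  hence W_const: "W e = W 0" for e
    by (induction e rule: int_induct[where k = 0]) (metis add_diff_cancel_right')+
  have decay: "vanishes_below (- 2 * e) (u 0 e)"
    if u: "solves_recurrences u" "\<And>e. e \<le> E \<Longrightarrow> vanishes_below 0 (u 0 e)" and e: "e < E" for u e
  proof -
    have "qhalf (2 * e) * u 0 e = u 0 e + u 0 e - u 0 (e + 1) - u 0 (e - 1)"
      using three_term_recurrence[OF u(1), of e] by (simp add: algebra_simps)
    moreover have "vanishes_below 0 \<dots>"
      using e by (intro vanishes_below_diff vanishes_below_add u(2)) auto
    ultimately have "vanishes_below 0 (qhalf (2 * e) * u 0 e)" by simp
    thus ?thesis by simp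
  qed
  have W_small: "vanishes_below (- 2 * e) (W e)" if e: "e < E" for e
  proof -
    have "vanishes_below (0 + - 2 * e) (f 0 (e + 1) * g 0 e)"
      using e by (intro vanishes_below_mult f_ge decay g g_ge) auto
    moreover have "vanishes_below (- 2 * e + 0) (f 0 e * g 0 (e + 1))"
      using e by (intro vanishes_below_mult g_ge decay f f_ge) auto
    ultimately show ?thesis unfolding W_def by (simp add: vanishes_below_diff)
  qed
  have "W 0 = 0"
  proof (rule eq_0_if_vanishes_below_all)
    fix d
    define e where "e = min (E - 1) (- \<bar>d\<bar>)"
    have "vanishes_below (- 2 * e) (W 0)"
      using W_small[of e] W_const[of e] by (simp add: e_def)
    thus "vanishes_below d (W 0)"
      by (rule vanishes_below_mono) (auto simp: e_def min_def)
  qed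
  hence W0: "f 0 1 * g 0 0 = f 0 0 * g 0 1" by (simp add: W_def)
  define h where "h m e = f 0 0 * g m e - g 0 0 * f m e" for m e
  have "solves_recurrences h"
    unfolding solves_recurrences_def
  proof (intro ballI allI)
    fix \<sigma> m e :: int assume "\<sigma> \<in> {1, -1}"
    have "qhalf e * h (m + \<sigma>) e + qhalf (-m) * h m (e + \<sigma>) =
        f 0 0 * (qhalf e * g (m + \<sigma>) e + qhalf (-m) * g m (e + \<sigma>)) -
        g 0 0 * (qhalf e * f (m + \<sigma>) e + qhalf (-m) * f m (e + \<sigma>))"
      by (simp add: h_def algebra_simps)
    also have "qhalf e * g (m + \<sigma>) e + qhalf (-m) * g m (e + \<sigma>) = g m e"
      using g \<open>\<sigma> \<in> {1, -1}\<close> unfolding solves_recurrences_def by blast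
    also have "qhalf e * f (m + \<sigma>) e + qhalf (-m) * f m (e + \<sigma>) = f m e"
      using f \<open>\<sigma> \<in> {1, -1}\<close> unfolding solves_recurrences_def by blast
    finally show "qhalf e * h (m + \<sigma>) e + qhalf (-m) * h m (e + \<sigma>) = h m e"
      by (simp add: h_def)
  qed
  hence "h m e = 0"
    by (rule solution_0_if_Cauchy_data_0) (use W0 in \<open>simp_all add: h_def mult.commute\<close>)
  thus ?thesis by (simp add: h_def)
qed

section \<open>The tetrahedron index solves the contiguity relations\<close>

text \<open>Setting \<open>1 / (q)\<^sub>n = 0\<close> for negative \<open>n\<close> keeps the recursion of the \<open>q\<close>-factorials valid for all
integers \<open>n\<close>, and turns \<^const>\<open>I_Delta\<close> into a sum over all of \<open>\<int>\<close>. The index shifts in the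
contiguity relations then produce no boundary terms.\<close>

definition qpoch_inv_int :: "int \<Rightarrow> int fls" where
  "qpoch_inv_int n = (if n < 0 then 0 else qpoch_inv (nat n))"

lemma qpoch_inv_int_pred: "qpoch_inv_int (n - 1) = (1 - qhalf (2 * n)) * qpoch_inv_int n"
proof (cases "n > 0")
  case True
  then obtain k where n: "n = int (Suc k)"
    by (metis gr0_conv_Suc zero_less_imp_eq_int)
  have "qpoch (Suc k) = qpoch k * (1 - qhalf (2 * n))"
    unfolding qpoch_def n by simp
  hence "qpoch_inv k * (qpoch k * (1 - qhalf (2 * n)) * qpoch_inv (Suc k)) = qpoch_inv k"
    using qpoch_mult_inv[of "Suc k"] by simp
  hence "(qpoch k * qpoch_inv k) * ((1 - qhalf (2 * n)) * qpoch_inv (Suc k)) = qpoch_inv k"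
    by (simp only: mult_ac)
  moreover have "nat n = Suc k" "nat (n - 1) = k" "n - 1 \<ge> 0" unfolding n by simp_all
  ultimately show ?thesis unfolding qpoch_inv_int_def using qpoch_mult_inv[of k] by simp
next
  case False
  thus ?thesis by (cases "n = 0") (auto simp: qpoch_inv_int_def)
qed

lemma vanishes_below_0_qpoch_inv_int: "vanishes_below 0 (qpoch_inv_int n)"
  using qpoch_inv_power_series power_series_iff_vanishes_below_0
  by (simp add: qpoch_inv_int_def)

definition I_Delta_summand :: "int \<Rightarrow> int \<Rightarrow> int \<Rightarrow> int fls" where
  "I_Delta_summand m e n = (if even n then 1 else -1) *
     (qhalf (n * (n + 1) - (2 * n + e) * m) * (qpoch_inv_int n * qpoch_inv_int (n + e)))"

lemma I_Delta_has_sum: "(I_Delta_summand m e has_sum I_Delta m e) UNIV"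
proof -
  have "(I_Delta_term m e has_sum I_Delta m e) {max 0 (-e)..}"
    unfolding I_Delta_def using I_Delta_summable by (rule has_sum_infsum)
  also have "?this \<longleftrightarrow> ?thesis"
  proof (rule has_sum_cong_neutral)
    fix n assume "n \<in> {max 0 (- e)..} \<inter> UNIV"
    thus "I_Delta_term m e n = I_Delta_summand m e n"
      by (auto simp: I_Delta_term_def I_Delta_summand_def qpoch_inv_int_def even_nat_iff)
  qed (auto simp: I_Delta_summand_def qpoch_inv_int_def)
  finally show ?thesis .
qed

lemma I_Delta_summand_recurrence_up:
  "qhalf e * I_Delta_summand (m + 1) e n + qhalf (-m) * I_Delta_summand m (e + 1) (n - 1)
     = I_Delta_summand m e n"
proof -
  \<comment> \<open>Shifting \<open>n\<close> flips the sign and the exponents differ by \<open>2 * n\<close>, so the recursion of \<open>1 / (q)\<^sub>n\<close> closes the identity.\<close>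
  define E where "E = n * (n + 1) - (2 * n + e) * m"
  have 1: "n * (n + 1) - (2 * n + e) * (m + 1) = E - 2 * n - e"
    "(n - 1) * (n - 1 + 1) - (2 * (n - 1) + (e + 1)) * m = E - 2 * n + m"
    "n - 1 + (e + 1) = n + e"
    by (simp_all add: E_def algebra_simps)
  have sign: "(if even (n - 1) then 1 else -1) = - (if even n then 1 else -1 :: int fls)"
    by simp
  have shift: "qhalf e * qhalf (E - 2 * n - e) = qhalf (E - 2 * n)"
    "qhalf (-m) * qhalf (E - 2 * n + m) = qhalf (E - 2 * n)"
    "qhalf E = qhalf (E - 2 * n) * qhalf (2 * n)"
    by (simp_all flip: qhalf_add)
  have "x * (s * (A * (P * Q))) + y * (- s * (B * ((1 - z) * P * Q))) = s * (F * (P * Q))"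
    if "x * A = K" "y * B = K" "F = K * z" for x y z s A B F K P Q :: "int fls"
  proof -
    have "x * (s * (A * (P * Q))) + y * (- s * (B * ((1 - z) * P * Q))) =
        s * ((x * A) * (P * Q)) - s * ((y * B) * ((1 - z) * (P * Q)))"
      by (simp add: algebra_simps)
    thus ?thesis unfolding that by (simp add: algebra_simps)
  qed
  from this[OF shift] show ?thesis
    unfolding I_Delta_summand_def qpoch_inv_int_pred 1 E_def[symmetric] sign .
qed

lemma I_Delta_summand_recurrence_down:
  "qhalf e * I_Delta_summand (m - 1) e n + qhalf (-m) * I_Delta_summand m (e - 1) n
     = I_Delta_summand m e n"
proof -
  define E where "E = n * (n + 1) - (2 * n + e) * m"
  have 1: "n * (n + 1) - (2 * n + e) * (m - 1) = E + 2 * (n + e) - e"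
    "n * (n + 1) - (2 * n + (e - 1)) * m = E + m"
    "n + (e - 1) = (n + e) - 1"
    by (simp_all add: E_def algebra_simps)
  have shift: "qhalf e * qhalf (E + 2 * (n + e) - e) = qhalf E * qhalf (2 * (n + e))"
    "qhalf (-m) * qhalf (E + m) = qhalf E"
    by (simp_all add: algebra_simps flip: qhalf_add)
  have "x * (s * (A * (P * Q))) + y * (s * (B * (P * ((1 - z) * Q)))) = s * (K * (P * Q))"
    if "x * A = K * z" "y * B = K" for x y z s A B K P Q :: "int fls"
  proof -
    have "x * (s * (A * (P * Q))) + y * (s * (B * (P * ((1 - z) * Q)))) =
        s * ((x * A) * (P * Q)) + s * ((y * B) * ((1 - z) * (P * Q)))"
      by (simp add: algebra_simps)
    thus ?thesis unfolding that by (simp add: algebra_simps)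
  qed
  from this[OF shift] show ?thesis
    unfolding I_Delta_summand_def 1 qpoch_inv_int_pred E_def[symmetric] .
qed

lemma I_Delta_solves_recurrences: "solves_recurrences I_Delta"
  unfolding solves_recurrences_def
proof (intro ballI allI)
  fix \<sigma> m e :: int assume "\<sigma> \<in> {1, -1}"
  then consider "\<sigma> = 1" | "\<sigma> = -1" by blast
  thus "qhalf e * I_Delta (m + \<sigma>) e + qhalf (-m) * I_Delta m (e + \<sigma>) = I_Delta m e"
  proof cases
    case 1
    have "((\<lambda>n. I_Delta_summand m (e + 1) (n - 1)) has_sum I_Delta m (e + 1)) UNIV"
      using has_sum_shift_int[of "I_Delta_summand m (e + 1)" "-1"] I_Delta_has_sum by simp
    hence "((\<lambda>n. qhalf e * I_Delta_summand (m + 1) e n + qhalf (-m) * I_Delta_summand m (e + 1) (n - 1))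
        has_sum (qhalf e * I_Delta (m + 1) e + qhalf (-m) * I_Delta m (e + 1))) UNIV"
      by (intro has_sum_add has_sum_cmult_right I_Delta_has_sum)
    thus ?thesis
      unfolding I_Delta_summand_recurrence_up 1 using I_Delta_has_sum has_sum_unique by blast
  next
    case 2
    have "((\<lambda>n. qhalf e * I_Delta_summand (m - 1) e n + qhalf (-m) * I_Delta_summand m (e - 1) n)
        has_sum (qhalf e * I_Delta (m - 1) e + qhalf (-m) * I_Delta m (e - 1))) UNIV"
      by (intro has_sum_add has_sum_cmult_right I_Delta_has_sum)
    hence "qhalf e * I_Delta (m - 1) e + qhalf (-m) * I_Delta m (e - 1) = I_Delta m e"
      unfolding I_Delta_summand_recurrence_down using I_Delta_has_sum has_sum_unique by blast
    thus ?thesis using 2 by simp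
  qed
qed

section \<open>Order estimates for the tetrahedron index\<close>

lemma vanishes_below_I_Delta_summand:
  assumes "0 \<le> n \<Longrightarrow> - e \<le> n \<Longrightarrow> d \<le> n * (n + 1) - (2 * n + e) * m"
  shows "vanishes_below d (I_Delta_summand m e n)"
proof (cases "0 \<le> n \<and> - e \<le> n")
  case True
  have "vanishes_below (0 + 0) (qpoch_inv_int n * qpoch_inv_int (n + e))"
    by (intro vanishes_below_mult vanishes_below_0_qpoch_inv_int)
  hence "vanishes_below d (qhalf (n * (n + 1) - (2 * n + e) * m) * (qpoch_inv_int n * qpoch_inv_int (n + e)))"
    using assms True by (auto elim: vanishes_below_mono)
  thus ?thesis by (auto simp: I_Delta_summand_def intro: vanishes_below_uminus)
next
  case False
  thus ?thesis by (auto simp: I_Delta_summand_def qpoch_inv_int_def)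
qed

lemma vanishes_below_I_Delta:
  assumes "\<And>n. 0 \<le> n \<Longrightarrow> - e \<le> n \<Longrightarrow> d \<le> n * (n + 1) - (2 * n + e) * m"
  shows "vanishes_below d (I_Delta m e)"
  using I_Delta_has_sum
  by (rule vanishes_below_has_sum) (use assms in \<open>auto intro: vanishes_below_I_Delta_summand\<close>)

text \<open>For \<open>m \<le> 0\<close> no cancellation occurs and the smallest admissible \<open>n\<close> gives the order of
\<^const>\<open>I_Delta\<close>: \<open>n = 0\<close> if \<open>e \<ge> 0\<close>, and \<open>n = -e\<close> if \<open>e \<le> 0\<close>.\<close>

lemma vanishes_below_I_Delta_nonpos_nonneg:
  assumes "m \<le> 0" "0 \<le> e"
  shows "vanishes_below (- m * e) (I_Delta m e)"
proof (rule vanishes_below_I_Delta)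
  fix n :: int assume "0 \<le> n"
  hence "0 \<le> n * (n + 1)" "0 \<le> 2 * n * (- m)"
    using assms by (auto intro!: mult_nonneg_nonneg simp del: mult_minus_right)
  thus "- m * e \<le> n * (n + 1) - (2 * n + e) * m" by (simp add: algebra_simps)
qed

lemma vanishes_below_I_Delta_nonpos_neg:
  assumes "m \<le> 0" "e \<le> 0"
  shows "vanishes_below (e * (e - 1) + m * e) (I_Delta m e)"
proof (rule vanishes_below_I_Delta)
  fix n :: int assume n: "- e \<le> n"
  have "(- e) * (- e + 1) \<le> n * (n + 1)" using n assms by (intro mult_mono) auto
  moreover have "(- e) * (- m) \<le> (2 * n + e) * (- m)"
    using n assms by (intro mult_right_mono) auto
  ultimately show "e * (e - 1) + m * e \<le> n * (n + 1) - (2 * n + e) * m"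
    by (simp add: algebra_simps)
qed

lemma vanishes_below_0_I_Delta_nonpos:
  assumes "m \<le> 0"
  shows "vanishes_below 0 (I_Delta m e)"
proof (cases "0 \<le> e")
  case True
  thus ?thesis using assms
    by (intro vanishes_below_mono[OF vanishes_below_I_Delta_nonpos_nonneg])
      (auto intro: mult_nonpos_nonneg)
next
  case False
  have "0 \<le> e * (e - 1) + m * e" using False assms
    by (intro add_nonneg_nonneg mult_nonpos_nonpos) auto
  thus ?thesis using assms False
    by (intro vanishes_below_mono[OF vanishes_below_I_Delta_nonpos_neg]) auto
qed

text \<open>The quadratic growth of the order for \<open>e \<rightarrow> -\<infinity>\<close>, for any \<open>m\<close>, makes the pentagon sum converge.\<close>

lemma vanishes_below_I_Delta_decay:
  assumes "2 * \<bar>m\<bar> \<le> s"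
  shows "vanishes_below (s * (s + 1 - 2 * \<bar>m\<bar>)) (I_Delta m (- s))"
proof (rule vanishes_below_I_Delta)
  fix n :: int assume n: "0 \<le> n" "- (- s) \<le> n"
  have "s * (s + 1 - 2 * \<bar>m\<bar>) \<le> n * (n + 1 - 2 * \<bar>m\<bar>)"
    using n assms by (intro mult_mono) auto
  also have "\<dots> \<le> n * (n + 1) - (2 * n - s) * \<bar>m\<bar>"
    using assms by (simp add: algebra_simps)
  also have "(2 * n - s) * m \<le> (2 * n - s) * \<bar>m\<bar>"
    using n assms by (intro mult_left_mono) auto
  hence "n * (n + 1) - (2 * n - s) * \<bar>m\<bar> \<le> n * (n + 1) - (2 * n + - s) * m" by simp
  finally show "s * (s + 1 - 2 * \<bar>m\<bar>) \<le> n * (n + 1) - (2 * n + - s) * m" .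
qed

text \<open>This fixes all normalisations: along \<open>e = 0\<close> the index tends to 1 as \<open>m \<rightarrow> -\<infinity>\<close>.\<close>

lemma I_Delta_e_0_near_1:
  assumes "m \<le> 0"
  shows "vanishes_below (2 - 2 * m) (I_Delta m 0 - 1)"
proof -
  have "vanishes_below (2 - 2 * m) (I_Delta m 0 - I_Delta_summand m 0 0)"
  proof (rule vanishes_below_has_sum_remainder[OF I_Delta_has_sum])
    fix n :: int assume "n \<noteq> 0"
    show "vanishes_below (2 - 2 * m) (I_Delta_summand m 0 n)"
    proof (rule vanishes_below_I_Delta_summand)
      assume "0 \<le> n"
      hence "1 * (1 + 1) \<le> n * (n + 1)" "2 * (- m) \<le> 2 * n * (- m)"
        using \<open>n \<noteq> 0\<close> assms by (intro mult_mono mult_right_mono; simp)+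
      thus "2 - 2 * m \<le> n * (n + 1) - (2 * n + 0) * m" by (simp add: algebra_simps)
    qed
  qed simp
  moreover have "qpoch_inv 0 = 1" using qpoch_mult_inv[of 0] by (simp add: qpoch_def)
  ultimately show ?thesis by (simp add: I_Delta_summand_def qpoch_inv_int_def)
qed

lemma I_Delta_0_0_nth_0: "fls_nth (I_Delta 0 0) 0 = 1"
  using I_Delta_e_0_near_1[of 0, unfolded vanishes_below_def, rule_format, of 0] by simp

lemma I_Delta_0_0_nonzero: "I_Delta 0 0 \<noteq> 0"
  using I_Delta_0_0_nth_0 by auto

section \<open>Triality and positivity\<close>

text \<open>The powers of \<open>-q\<^sup>1\<^sup>/\<^sup>2\<close>. The sign is written as a case distinction because \<open>k\<close> may be negative.\<close>

definition neg_qhalf :: "int \<Rightarrow> int fls" where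
  "neg_qhalf k = (if even k then 1 else -1) * qhalf k"

lemma neg_qhalf_add: "neg_qhalf (a + b) = neg_qhalf a * neg_qhalf b"
  by (simp add: neg_qhalf_def qhalf_add)

lemma neg_qhalf_0 [simp]: "neg_qhalf 0 = 1"
  by (simp add: neg_qhalf_def)

lemma vanishes_below_neg_qhalf_mult [simp]:
  "vanishes_below d (neg_qhalf k * s) \<longleftrightarrow> vanishes_below (d - k) s"
  using vanishes_below_qhalf_mult[of d k s]
    vanishes_below_uminus[of d "qhalf k * s"] vanishes_below_uminus[of d "- (qhalf k * s)"]
  by (auto simp: neg_qhalf_def simp del: vanishes_below_qhalf_mult)

text \<open>The contiguity relations are invariant under the rotation of order 3 that sends \<open>(m, e)\<close> to
\<open>(e, -e - m)\<close>, once the solution is multiplied by the stated power of \<open>-q\<^sup>1\<^sup>/\<^sup>2\<close>: at the rotated point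
the same relation holds with its three terms permuted.\<close>

lemma solves_recurrences_rotate:
  assumes "solves_recurrences f"
  shows "solves_recurrences (\<lambda>m e. neg_qhalf (- e) * f e (- e - m))"
  unfolding solves_recurrences_def
proof (intro ballI allI)
  fix \<sigma> m e :: int assume \<sigma>: "\<sigma> \<in> {1, -1}"
  have cancel: "q * (N * a) + y * (- (z * N) * b) = N * c"
    if "q' * b = a - r * c" "q * q' = y * z" "q * r = 1" for q q' r y z N a b c :: "int fls"
  proof -
    have "(y * z) * b = q * (q' * b)" unfolding that(2)[symmetric] by (simp add: mult.assoc)
    also have "\<dots> = q * a - (q * r) * c" unfolding that(1) by (simp add: algebra_simps)
    finally have "(y * z) * b = q * a - c" unfolding that(3) by simp
    moreover have "q * (N * a) + y * (- (z * N) * b) = N * (q * a - (y * z) * b)"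
      by (simp add: algebra_simps)
    ultimately show ?thesis by simp
  qed
  have "qhalf e * (neg_qhalf (- e) * f e (- e - m - \<sigma>)) +
      qhalf (- m) * (- (qhalf (- \<sigma>) * neg_qhalf (- e)) * f (e + \<sigma>) (- e - m - \<sigma>)) =
      neg_qhalf (- e) * f e (- e - m)"
  proof (rule cancel)
    show "qhalf (- e - m - \<sigma>) * f (e + \<sigma>) (- e - m - \<sigma>) =
        f e (- e - m - \<sigma>) - qhalf (- e) * f e (- e - m)"
      using solves_recurrences_step[OF assms \<sigma>, of "- e - m - \<sigma>" e] by simp
  qed (simp_all flip: qhalf_add)
  moreover have "neg_qhalf (- (e + \<sigma>)) = - (qhalf (- \<sigma>) * neg_qhalf (- e))"
    using neg_qhalf_add[of "- e" "- \<sigma>"] \<sigma> by (auto simp: neg_qhalf_def[of 1] neg_qhalf_def[of "- 1"] mult.commute)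
  moreover have "- e - (m + \<sigma>) = - e - m - \<sigma>" "- (e + \<sigma>) - m = - e - m - \<sigma>" by simp_all
  ultimately show "qhalf e * (neg_qhalf (- e) * f e (- e - (m + \<sigma>))) +
      qhalf (- m) * (neg_qhalf (- (e + \<sigma>)) * f (e + \<sigma>) (- (e + \<sigma>) - m)) =
      neg_qhalf (- e) * f e (- e - m)"
    by (simp only:)
qed

text \<open>Both sides solve the contiguity relations, and on the half-line \<open>m = 0\<close>, \<open>e \<le> 0\<close> both only involve
values of \<^const>\<open>I_Delta\<close> at a first argument \<open>\<le> 0\<close>, which are power series. At the origin they
coincide.\<close>

theorem I_Delta_triality: "I_Delta m e = neg_qhalf (- e) * I_Delta e (- e - m)"
proof -
  have "I_Delta 0 0 * (neg_qhalf (- e) * I_Delta e (- e - m)) =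
      neg_qhalf (- 0) * I_Delta 0 (- 0 - 0) * I_Delta m e"
  proof (rule bounded_solutions_proportional[OF I_Delta_solves_recurrences
        solves_recurrences_rotate[OF I_Delta_solves_recurrences], where E = 0])
    fix e :: int assume e: "e \<le> 0"
    show "vanishes_below 0 (I_Delta 0 e)"
      by (rule vanishes_below_0_I_Delta_nonpos) simp
    show "vanishes_below 0 (neg_qhalf (- e) * I_Delta e (- e - 0))"
      using e by (auto intro!: vanishes_below_mono[OF vanishes_below_0_I_Delta_nonpos])
  qed
  thus ?thesis using I_Delta_0_0_nonzero by simp
qed

text \<open>For \<open>m > 0\<close> the defining sum can have summands of negative order, which then cancel. Triality, applied once if
\<open>e \<le> 0\<close> and twice if \<open>e > 0\<close>, moves the first argument to the half-plane where no
cancellation is needed, at the cost of a nonnegative power of \<open>-q\<^sup>1\<^sup>/\<^sup>2\<close>.\<close>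

lemma I_Delta_power_series: "vanishes_below 0 (I_Delta m e)"
proof -
  consider "m \<le> 0" | "m > 0" "e \<le> 0" | "m > 0" "e > 0" by linarith
  thus ?thesis
  proof cases
    case 1
    thus ?thesis by (rule vanishes_below_0_I_Delta_nonpos)
  next
    case 2
    hence "vanishes_below (0 - (- e)) (I_Delta e (- e - m))"
      by (intro vanishes_below_mono[OF vanishes_below_0_I_Delta_nonpos]) auto
    thus ?thesis unfolding I_Delta_triality[of m e] by simp
  next
    case 3
    have "neg_qhalf m * I_Delta (- e - m) m = neg_qhalf m * (neg_qhalf (- m) * I_Delta m e)"
      using I_Delta_triality[of "- e - m" m] by simp
    also have "\<dots> = (neg_qhalf m * neg_qhalf (- m)) * I_Delta m e" by simp
    also have "\<dots> = I_Delta m e" by (simp flip: neg_qhalf_add)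
    finally have "I_Delta m e = neg_qhalf m * I_Delta (- e - m) m" ..
    moreover have "vanishes_below (0 - m) (I_Delta (- e - m) m)"
      using 3 by (intro vanishes_below_mono[OF vanishes_below_0_I_Delta_nonpos]) auto
    ultimately show ?thesis by simp
  qed
qed

section \<open>The pentagon identity\<close>

text \<open>The pentagon sum has \<open>c = 2\<close> and \<open>M = m1 + m2\<close>; the telescoping series that proves its recurrences
has \<open>c = 1\<close> and \<open>M = m1 + m2 + \<sigma>\<close> with \<open>\<sigma> = \<plusminus>1\<close>.\<close>

definition pentagon_summand :: "int \<Rightarrow> int \<Rightarrow> int \<Rightarrow> int \<Rightarrow> int \<Rightarrow> int \<Rightarrow> int \<Rightarrow> int fls" where
  "pentagon_summand c M m1 m2 e1 e2 k =
     qhalf (c * k) * I_Delta m1 (e1 + k) * I_Delta m2 (e2 + k) * I_Delta M k"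

lemma vanishes_below_triple_product:
  fixes r s t :: "'a::semiring_0 fls"
  assumes "vanishes_below a r" "vanishes_below b s" "vanishes_below c t"
  shows "vanishes_below (a + b + c) (r * s * t)"
  using assms by (intro vanishes_below_mult)

lemma vanishes_below_pentagon_summand:
  assumes "vanishes_below a (I_Delta m1 (e1 + k))" "vanishes_below b (I_Delta m2 (e2 + k))"
    "vanishes_below d (I_Delta M k)" "l \<le> c * k + a + b + d"
  shows "vanishes_below l (pentagon_summand c M m1 m2 e1 e2 k)"
proof -
  have "vanishes_below (l - c * k) (I_Delta m1 (e1 + k) * I_Delta m2 (e2 + k) * I_Delta M k)"
    by (rule vanishes_below_mono[OF vanishes_below_triple_product[OF assms(1-3)]])
      (use assms(4) in simp)
  thus ?thesis by (simp add: pentagon_summand_def mult.assoc)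
qed

text \<open>As \<open>k \<rightarrow> \<infinity>\<close> the weight \<open>q\<^sup>c\<^sup>k\<^sup>/\<^sup>2\<close> suffices, since the other factors are power series; as \<open>k \<rightarrow> -\<infinity>\<close>
the quadratic order of the last factor dominates the weight.\<close>

lemma pentagon_summand_summable:
  assumes "c > 0"
  shows "pentagon_summand c M m1 m2 e1 e2 summable_on UNIV"
  unfolding summable_fls_cofinite
proof
  fix d :: int
  define B where "B = \<bar>d\<bar> + 2 * \<bar>M\<bar> + c"
  have "vanishes_below d (pentagon_summand c M m1 m2 e1 e2 k)" if "k \<notin> {-B..B}" for k
  proof (cases "k \<ge> 0")
    case True
    hence "1 * k \<le> c * k" using assms by (intro mult_right_mono) auto
    hence "d \<le> c * k + 0 + 0 + 0" using that True assms by (auto simp: B_def)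
    thus ?thesis
      by (intro vanishes_below_pentagon_summand[where a = 0 and b = 0 and d = 0] I_Delta_power_series)
  next
    case False
    define s where "s = - k"
    have s: "s > B" using that False by (auto simp: s_def B_def)
    hence "s * 1 \<le> s * (s + 1 - 2 * \<bar>M\<bar> - c)"
      using assms by (intro mult_left_mono) (auto simp: B_def)
    hence "d \<le> c * k + 0 + 0 + s * (s + 1 - 2 * \<bar>M\<bar>)"
      using s assms by (simp add: B_def s_def algebra_simps)
    moreover have "vanishes_below (s * (s + 1 - 2 * \<bar>M\<bar>)) (I_Delta M k)"
      using vanishes_below_I_Delta_decay[of M s] s assms by (simp add: s_def B_def)
    ultimately show ?thesis
      by (intro vanishes_below_pentagon_summand[where a = 0 and b = 0 and d = "s * (s + 1 - 2 * \<bar>M\<bar>)"]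
          I_Delta_power_series)
  qed
  hence "{k \<in> UNIV. \<not> vanishes_below d (pentagon_summand c M m1 m2 e1 e2 k)} \<subseteq> {-B..B}" by blast
  thus "finite {k \<in> UNIV. \<not> vanishes_below d (pentagon_summand c M m1 m2 e1 e2 k)}"
    using finite_subset by blast
qed

definition pentagon_sum :: "int \<Rightarrow> int \<Rightarrow> int \<Rightarrow> int \<Rightarrow> int fls" where
  "pentagon_sum m1 m2 e1 e2 = (\<Sum>\<^sub>\<infinity>k. pentagon_summand 2 (m1 + m2) m1 m2 e1 e2 k)"

lemma pentagon_sum_has_sum:
  "(pentagon_summand 2 (m1 + m2) m1 m2 e1 e2 has_sum pentagon_sum m1 m2 e1 e2) UNIV"
  unfolding pentagon_sum_def by (intro has_sum_infsum pentagon_summand_summable) simp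

lemma pentagon_sum_swap: "pentagon_sum m1 m2 e1 e2 = pentagon_sum m2 m1 e2 e1"
  by (simp add: pentagon_sum_def pentagon_summand_def mult_ac add.commute)

text \<open>Apply the contiguity relation to the first factor of the first summand and to the second factor of the
second summand: the mixed terms cancel. The relation with the opposite sign, applied to the last factor,
identifies what is left over as the pentagon summand at \<open>k + \<sigma>\<close> plus a difference of consecutive
terms.\<close>

lemma pentagon_summand_telescoping:
  assumes \<sigma>: "\<sigma> \<in> {1, -1}"
  shows "qhalf e1 * pentagon_summand 2 (m1 + m2 + \<sigma>) (m1 + \<sigma>) m2 e1 e2 k +
      qhalf (e2 - m1) * pentagon_summand 2 (m1 + m2 + \<sigma>) m1 (m2 + \<sigma>) (e1 + \<sigma>) e2 k =
    pentagon_summand 1 (m1 + m2 + \<sigma>) m1 m2 e1 e2 k -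
      pentagon_summand 1 (m1 + m2 + \<sigma>) m1 m2 e1 e2 (k + \<sigma>) +
      pentagon_summand 2 (m1 + m2) m1 m2 e1 e2 (k + \<sigma>)"
proof -
  note step = solves_recurrences_step[OF I_Delta_solves_recurrences]
  define x where "x = I_Delta m1 (e1 + k)"
  define x' where "x' = I_Delta m1 (e1 + (k + \<sigma>))"
  define y where "y = I_Delta m2 (e2 + k)"
  define y' where "y' = I_Delta m2 (e2 + (k + \<sigma>))"
  define z where "z = I_Delta (m1 + m2 + \<sigma>) k"
  have step1: "qhalf (e1 + k) * I_Delta (m1 + \<sigma>) (e1 + k) = x - qhalf (- m1) * x'"
    using step[OF \<sigma>, of "e1 + k" m1] by (simp add: x_def x'_def add.assoc)
  have step2: "qhalf (e2 + k) * I_Delta (m2 + \<sigma>) (e2 + k) = y - qhalf (- m2) * y'"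
    using step[OF \<sigma>, of "e2 + k" m2] by (simp add: y_def y'_def add.assoc)
  have step3: "qhalf (k + \<sigma>) * I_Delta (m1 + m2) (k + \<sigma>) =
      I_Delta (m1 + m2 + \<sigma>) (k + \<sigma>) - qhalf (- (m1 + m2 + \<sigma>)) * z"
    using step[of "- \<sigma>" "k + \<sigma>" "m1 + m2 + \<sigma>"] \<sigma> by (auto simp: z_def)
  have "qhalf e1 * pentagon_summand 2 (m1 + m2 + \<sigma>) (m1 + \<sigma>) m2 e1 e2 k =
      qhalf k * (qhalf (e1 + k) * I_Delta (m1 + \<sigma>) (e1 + k)) * y * z"
    unfolding pentagon_summand_def y_def z_def mult_2 qhalf_add by (simp only: mult_ac)
  also have "\<dots> = qhalf k * x * y * z - qhalf (k - m1) * x' * y * z"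
    using qhalf_add[of k "- m1"] unfolding step1 by (simp add: algebra_simps)
  finally have 1: "qhalf e1 * pentagon_summand 2 (m1 + m2 + \<sigma>) (m1 + \<sigma>) m2 e1 e2 k =
      qhalf k * x * y * z - qhalf (k - m1) * x' * y * z" .
  have "qhalf (e2 - m1) * pentagon_summand 2 (m1 + m2 + \<sigma>) m1 (m2 + \<sigma>) (e1 + \<sigma>) e2 k =
      (qhalf (e2 - m1) * qhalf (2 * k)) * x' * I_Delta (m2 + \<sigma>) (e2 + k) * z"
    unfolding pentagon_summand_def x'_def z_def by (simp only: mult_ac add_ac)
  also have "qhalf (e2 - m1) * qhalf (2 * k) = qhalf (k - m1) * qhalf (e2 + k)"
    by (simp add: algebra_simps flip: qhalf_add)
  also have "qhalf (k - m1) * qhalf (e2 + k) * x' * I_Delta (m2 + \<sigma>) (e2 + k) * z =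
      qhalf (k - m1) * x' * (qhalf (e2 + k) * I_Delta (m2 + \<sigma>) (e2 + k)) * z"
    by (simp only: mult_ac)
  also have "\<dots> = qhalf (k - m1) * x' * y * z - (qhalf (k - m1) * qhalf (- m2)) * x' * y' * z"
    unfolding step2 by (simp add: right_diff_distrib left_diff_distrib mult_ac)
  also have "qhalf (k - m1) * qhalf (- m2) = qhalf (k - m1 - m2)"
    by (simp add: algebra_simps flip: qhalf_add)
  finally have 2: "qhalf (e2 - m1) * pentagon_summand 2 (m1 + m2 + \<sigma>) m1 (m2 + \<sigma>) (e1 + \<sigma>) e2 k =
      qhalf (k - m1) * x' * y * z - qhalf (k - m1 - m2) * x' * y' * z" .
  have "pentagon_summand 2 (m1 + m2) m1 m2 e1 e2 (k + \<sigma>) =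
      qhalf (k + \<sigma>) * x' * y' * (qhalf (k + \<sigma>) * I_Delta (m1 + m2) (k + \<sigma>))"
    unfolding pentagon_summand_def x'_def y'_def mult_2 qhalf_add by (simp only: mult_ac)
  also have "\<dots> = qhalf (k + \<sigma>) * x' * y' * I_Delta (m1 + m2 + \<sigma>) (k + \<sigma>) -
      (qhalf (k + \<sigma>) * qhalf (- (m1 + m2 + \<sigma>))) * x' * y' * z"
    unfolding step3 by (simp only: right_diff_distrib mult_ac)
  also have "qhalf (k + \<sigma>) * qhalf (- (m1 + m2 + \<sigma>)) = qhalf (k - m1 - m2)"
    by (simp add: algebra_simps flip: qhalf_add)
  finally have 3: "pentagon_summand 2 (m1 + m2) m1 m2 e1 e2 (k + \<sigma>) =
      qhalf (k + \<sigma>) * x' * y' * I_Delta (m1 + m2 + \<sigma>) (k + \<sigma>) - qhalf (k - m1 - m2) * x' * y' * z" .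
  have 4: "pentagon_summand 1 (m1 + m2 + \<sigma>) m1 m2 e1 e2 k = qhalf k * x * y * z"
    "pentagon_summand 1 (m1 + m2 + \<sigma>) m1 m2 e1 e2 (k + \<sigma>) =
      qhalf (k + \<sigma>) * x' * y' * I_Delta (m1 + m2 + \<sigma>) (k + \<sigma>)"
    by (simp_all add: pentagon_summand_def x_def y_def z_def x'_def y'_def)
  show ?thesis unfolding 1 2 3 4 by simp
qed

text \<open>In the variables \<open>a = m1 - e2\<close> and \<open>b = m2 - e1\<close> the product side of the pentagon identity is
\<open>I_Delta a e1 * I_Delta b e2\<close>, a solution in \<open>(a, e1)\<close>; the sum solves the same relations in these
variables.\<close>

lemma pentagon_sum_solves_recurrences:
  "solves_recurrences (\<lambda>a e1. pentagon_sum (a + e2) (b + e1) e1 e2)"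
  unfolding solves_recurrences_def
proof (intro ballI allI)
  fix \<sigma> a e1 :: int assume \<sigma>: "\<sigma> \<in> {1, -1}"
  define m1 where "m1 = a + e2"
  define m2 where "m2 = b + e1"
  define u where "u = pentagon_summand 1 (m1 + m2 + \<sigma>) m1 m2 e1 e2"
  define U where "U = (\<Sum>\<^sub>\<infinity>k. u k)"
  have "(u has_sum U) UNIV"
    unfolding U_def u_def by (intro has_sum_infsum pentagon_summand_summable) simp
  moreover from this have "((\<lambda>k. u (k + \<sigma>)) has_sum U) UNIV"
    by (simp add: has_sum_shift_int)
  moreover have "((\<lambda>k. pentagon_summand 2 (m1 + m2) m1 m2 e1 e2 (k + \<sigma>)) has_sum
      pentagon_sum m1 m2 e1 e2) UNIV"
    using pentagon_sum_has_sum by (simp add: has_sum_shift_int)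
  ultimately have "((\<lambda>k. u k + - u (k + \<sigma>) + pentagon_summand 2 (m1 + m2) m1 m2 e1 e2 (k + \<sigma>))
      has_sum (U + - U + pentagon_sum m1 m2 e1 e2)) UNIV"
    by (intro has_sum_add has_sum_uminusI)
  hence sum1: "((\<lambda>k. qhalf e1 * pentagon_summand 2 (m1 + m2 + \<sigma>) (m1 + \<sigma>) m2 e1 e2 k +
      qhalf (e2 - m1) * pentagon_summand 2 (m1 + m2 + \<sigma>) m1 (m2 + \<sigma>) (e1 + \<sigma>) e2 k)
      has_sum pentagon_sum m1 m2 e1 e2) UNIV"
    unfolding pentagon_summand_telescoping[OF \<sigma>] u_def by simp
  have sum2: "((\<lambda>k. qhalf e1 * pentagon_summand 2 (m1 + m2 + \<sigma>) (m1 + \<sigma>) m2 e1 e2 k +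
      qhalf (e2 - m1) * pentagon_summand 2 (m1 + m2 + \<sigma>) m1 (m2 + \<sigma>) (e1 + \<sigma>) e2 k)
      has_sum (qhalf e1 * pentagon_sum (m1 + \<sigma>) m2 e1 e2 +
        qhalf (e2 - m1) * pentagon_sum m1 (m2 + \<sigma>) (e1 + \<sigma>) e2)) UNIV"
    using pentagon_sum_has_sum[of "m1 + \<sigma>" m2 e1 e2] pentagon_sum_has_sum[of m1 "m2 + \<sigma>" "e1 + \<sigma>" e2]
    by (intro has_sum_add has_sum_cmult_right) (simp_all add: add_ac)
  have "qhalf e1 * pentagon_sum (m1 + \<sigma>) m2 e1 e2 +
        qhalf (e2 - m1) * pentagon_sum m1 (m2 + \<sigma>) (e1 + \<sigma>) e2 = pentagon_sum m1 m2 e1 e2"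
    by (rule has_sum_unique[OF sum2 sum1])
  thus "qhalf e1 * pentagon_sum (a + \<sigma> + e2) (b + e1) e1 e2 +
      qhalf (- a) * pentagon_sum (a + e2) (b + (e1 + \<sigma>)) (e1 + \<sigma>) e2 =
      pentagon_sum (a + e2) (b + e1) e1 e2"
    by (simp add: m1_def m2_def add_ac)
qed

text \<open>For \<open>m1 + m2 \<le> 0\<close> the order of the last factor at \<open>k < 0\<close> compensates the negative
weight. This covers \<open>a = 0\<close> and \<open>e1 \<rightarrow> -\<infinity>\<close> for fixed \<open>b\<close> and \<open>e2\<close>, as
\<open>m1 + m2 = a + b + e1 + e2\<close>.\<close>

lemma pentagon_sum_power_series:
  assumes "m1 + m2 \<le> 0"
  shows "vanishes_below 0 (pentagon_sum m1 m2 e1 e2)"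
proof (rule vanishes_below_has_sum[OF pentagon_sum_has_sum])
  fix k
  show "vanishes_below 0 (pentagon_summand 2 (m1 + m2) m1 m2 e1 e2 k)"
  proof (cases "k \<ge> 0")
    case True
    thus ?thesis
      by (intro vanishes_below_pentagon_summand[where a = 0 and b = 0 and d = 0]
          I_Delta_power_series) auto
  next
    case False
    have "2 * k + k * (k - 1) = k * (k + 1)" by (simp add: algebra_simps)
    moreover have "0 \<le> k * (k + 1)" "0 \<le> (m1 + m2) * k"
      using False assms by (intro mult_nonpos_nonpos; simp)+
    ultimately have "0 \<le> 2 * k + 0 + 0 + (k * (k - 1) + (m1 + m2) * k)" by linarith
    thus ?thesis
      using False assms
      by (intro vanishes_below_pentagon_summand[where a = 0 and b = 0
            and d = "k * (k - 1) + (m1 + m2) * k"]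
          I_Delta_power_series vanishes_below_I_Delta_nonpos_neg) auto
  qed
qed

lemma pentagon_sum_proportional:
  "I_Delta 0 0 * pentagon_sum (a + e2) (b + e1) e1 e2 = pentagon_sum e2 b 0 e2 * I_Delta a e1"
proof -
  have "I_Delta 0 0 * pentagon_sum (a + e2) (b + e1) e1 e2 =
      pentagon_sum (0 + e2) (b + 0) 0 e2 * I_Delta a e1"
  proof (rule bounded_solutions_proportional[OF I_Delta_solves_recurrences
        pentagon_sum_solves_recurrences, where E = "- (b + e2)"])
    fix e :: int assume "e \<le> - (b + e2)"
    thus "vanishes_below 0 (pentagon_sum (0 + e2) (b + e) e e2)"
      by (intro pentagon_sum_power_series) auto
  qed (rule I_Delta_power_series)
  thus ?thesis by simp
qed

text \<open>For \<open>m1 = m2 = -N\<close> and \<open>e1 = e2 = 0\<close> only the summand \<open>k = 0\<close> has order less than \<open>N\<close>, and its three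
factors are close to 1.\<close>

lemma pentagon_sum_near_1:
  assumes "N \<ge> 0"
  shows "vanishes_below N (pentagon_sum (- N) (- N) 0 0 - 1)"
proof -
  let ?t = "pentagon_summand 2 (- N + - N) (- N) (- N) 0 0"
  have "vanishes_below N (pentagon_sum (- N) (- N) 0 0 - ?t 0)"
  proof (rule vanishes_below_has_sum_remainder[OF pentagon_sum_has_sum])
    fix k :: int assume "k \<noteq> 0"
    show "vanishes_below N (?t k)"
    proof (cases "k > 0")
      case True
      have "N * 1 \<le> N * k" using True assms by (intro mult_left_mono) auto
      thus ?thesis using True assms
        by (intro vanishes_below_pentagon_summand[where a = 0 and b = 0 and d = "- (- N + - N) * k"]
            I_Delta_power_series vanishes_below_I_Delta_nonpos_nonneg) auto
    next
      case False
      hence "N * 1 \<le> N * (- k)" using \<open>k \<noteq> 0\<close> assms by (intro mult_left_mono) auto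
      moreover have "0 \<le> k * (k + 1)"
        using False \<open>k \<noteq> 0\<close> by (intro mult_nonpos_nonpos) auto
      ultimately have "N \<le> 2 * k + 0 + 0 + (k * (k - 1) + (- N + - N) * k)"
        using assms by (simp add: algebra_simps)
      thus ?thesis using False assms
        by (intro vanishes_below_pentagon_summand[where a = 0 and b = 0
              and d = "k * (k - 1) + (- N + - N) * k"]
            I_Delta_power_series vanishes_below_I_Delta_nonpos_neg) auto
    qed
  qed simp
  moreover have "vanishes_below N (?t 0 - 1)"
  proof -
    define x where "x = I_Delta (- N) 0"
    define z where "z = I_Delta (- N + - N) 0"
    have near: "vanishes_below N (x - 1)" "vanishes_below N (z - 1)"
      unfolding x_def z_def
      by (rule vanishes_below_mono[OF I_Delta_e_0_near_1]; use assms in simp)+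
    have ps: "vanishes_below 0 x" "vanishes_below 0 z"
      by (simp_all add: x_def z_def I_Delta_power_series)
    have "vanishes_below (N + 0 + 0) ((x - 1) * x * z)"
      by (intro vanishes_below_triple_product near ps)
    moreover have "vanishes_below (N + 0) ((x - 1) * z)"
      by (intro vanishes_below_mult near ps)
    ultimately have "vanishes_below N ((x - 1) * x * z + (x - 1) * z + (z - 1))"
      using near by (intro vanishes_below_add) simp_all
    also have "(x - 1) * x * z + (x - 1) * z + (z - 1) = ?t 0 - 1"
      by (simp add: pentagon_summand_def x_def z_def algebra_simps)
    finally show ?thesis .
  qed
  ultimately have "vanishes_below N ((pentagon_sum (- N) (- N) 0 0 - ?t 0) + (?t 0 - 1))"
    by (rule vanishes_below_add)
  thus ?thesis by simp
qed

text \<open>Rigidity separates the variables \<open>(a, e1)\<close>; by the symmetry of the sum it then separates \<open>(b, e2)\<close>.\<close>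

lemma pentagon_sum_factorization:
  "(I_Delta 0 0)\<^sup>2 * pentagon_sum (a + e2) (b + e1) e1 e2 =
     pentagon_sum 0 0 0 0 * (I_Delta a e1 * I_Delta b e2)"
proof -
  have "I_Delta 0 0 * pentagon_sum e2 b 0 e2 = pentagon_sum 0 0 0 0 * I_Delta b e2"
    using pentagon_sum_proportional[of b 0 0 e2] pentagon_sum_swap by simp
  thus ?thesis
    using pentagon_sum_proportional[of a e2 b e1] by (simp add: power2_eq_square mult_ac)
qed

text \<open>The remaining constant is found in the limit \<open>a = b \<rightarrow> -\<infinity>\<close>, \<open>e1 = e2 = 0\<close>, where the pentagon sum and
both factors \<^const>\<open>I_Delta\<close> tend to 1.\<close>

lemma pentagon_sum_0: "pentagon_sum 0 0 0 0 = (I_Delta 0 0)\<^sup>2"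
proof -
  define c where "c = pentagon_sum 0 0 0 0"
  have "c - (I_Delta 0 0)\<^sup>2 = 0"
  proof (rule eq_0_if_vanishes_below_all)
    fix d :: int
    define N where "N = \<bar>d\<bar>"
    define x where "x = I_Delta (- N) 0"
    define p where "p = pentagon_sum (- N) (- N) 0 0"
    have "vanishes_below N (x - 1)"
      unfolding x_def by (rule vanishes_below_mono[OF I_Delta_e_0_near_1]) (auto simp: N_def)
    moreover have "vanishes_below 0 (x + 1)"
      by (intro vanishes_below_add)
        (simp_all add: x_def I_Delta_power_series, simp add: vanishes_below_def)
    moreover have "vanishes_below 0 c"
      unfolding c_def by (rule pentagon_sum_power_series) simp
    ultimately have "vanishes_below (N + 0 + 0) ((x - 1) * (x + 1) * c)"
      by (intro vanishes_below_triple_product)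
    moreover have "vanishes_below (0 + 0 + N) (I_Delta 0 0 * I_Delta 0 0 * (p - 1))"
      unfolding p_def
      by (intro vanishes_below_triple_product pentagon_sum_near_1 I_Delta_power_series)
        (simp add: N_def)
    moreover have "(I_Delta 0 0)\<^sup>2 * p = c * (x * x)"
      using pentagon_sum_factorization[of "- N" 0 "- N" 0] by (simp add: p_def c_def x_def)
    hence "c - (I_Delta 0 0)\<^sup>2 = I_Delta 0 0 * I_Delta 0 0 * (p - 1) - (x - 1) * (x + 1) * c"
      by (simp add: power2_eq_square algebra_simps)
    ultimately have "vanishes_below N (c - (I_Delta 0 0)\<^sup>2)"
      by (simp add: vanishes_below_diff)
    thus "vanishes_below d (c - (I_Delta 0 0)\<^sup>2)"
      by (rule vanishes_below_mono) (simp add: N_def)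
  qed
  thus ?thesis by (simp add: c_def)
qed

theorem I_Delta_pentagon_identity: "pentagon_identity I_Delta"
  unfolding pentagon_identity_def
proof (intro allI)
  fix m1 m2 e1 e2
  have "pentagon_sum m1 m2 e1 e2 = I_Delta (m1 - e2) e1 * I_Delta (m2 - e1) e2"
    using pentagon_sum_factorization[of "m1 - e2" e2 "m2 - e1" e1] I_Delta_0_0_nonzero
    by (simp add: pentagon_sum_0)
  thus "((\<lambda>e3. qhalf (2 * e3) * I_Delta m1 (e1 + e3) * I_Delta m2 (e2 + e3) * I_Delta (m1 + m2) e3)
      has_sum I_Delta (m1 - e2) e1 * I_Delta (m2 - e1) e2) UNIV"
    using pentagon_sum_has_sum[of m1 m2 e1 e2] by (simp add: pentagon_summand_def[abs_def])
qed

section \<open>Parity\<close>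

lemma laurent_q_iff: "s \<in> laurent_q \<longleftrightarrow> (\<forall>k. odd k \<longrightarrow> fls_nth s k = 0)"
proof
  assume *: "\<forall>k. odd k \<longrightarrow> fls_nth s k = 0"
  define g where "g = Abs_fls (\<lambda>k. fls_nth s (2 * k))"
  have "fls_nth g k = fls_nth s (2 * k)" for k
    unfolding g_def
    by (rule nth_Abs_fls_lower_bound[where N = "- \<bar>fls_subdegree s\<bar>"]) auto
  hence "s = fls_compose_power g 2"
    using * by (intro fls_eqI) (auto simp: fls_nth_compose_power)
  thus "s \<in> laurent_q" by (auto simp: laurent_q_def)
qed (auto simp: laurent_q_def fls_nth_compose_power)

lemma laurent_q_mult: "s \<in> laurent_q \<Longrightarrow> t \<in> laurent_q \<Longrightarrow> s * t \<in> laurent_q"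
  unfolding laurent_q_def by (auto simp flip: fls_compose_power_mult)

text \<open>Inverting before substituting \<open>q\<close> for the variable gives an inverse in \<^const>\<open>laurent_q\<close>, and
inverses are unique.\<close>

lemma qpoch_inv_laurent_q: "qpoch_inv n \<in> laurent_q"
proof -
  \<comment> \<open>\<open>qpoch n\<close> with the variable itself in place of \<open>q\<close>.\<close>
  define P where "P = (\<Prod>i=1..n. (1 - fls_X_intpow (int i)) :: int fls)"
  have P: "fls_nth P 0 = 1 \<and> (\<forall>k<0. fls_nth P k = 0)"
    unfolding P_def
  proof (induction n)
    case (Suc n)
    let ?p = "\<Prod>i=1..n. (1 - fls_X_intpow (int i)) :: int fls"
    have "(\<Prod>i=1..Suc n. (1 - fls_X_intpow (int i)) :: int fls) =
        ?p - ?p * fls_X_intpow (int (Suc n))"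
      by (simp add: algebra_simps)
    also have "\<dots> = ?p - fls_shift (- int (Suc n)) ?p"
      by (simp only: fls_X_intpow_times_conv_shift)
    finally show ?case using Suc by simp
  qed simp
  hence "fls_subdegree P = 0" by (intro fls_subdegree_eqI) auto
  hence "P * fls_right_inverse P 1 = 1"
    using P by (intro fls_right_inverse) auto
  then obtain R where "P * R = 1" by blast
  hence "fls_compose_power (P * R) 2 = 1" by simp
  hence "fls_compose_power P 2 * fls_compose_power R 2 = 1"
    by (simp only: fls_compose_power_mult)
  moreover have "fls_compose_power P 2 = qpoch n"
  proof -
    have "fls_compose_power (\<Prod>i\<in>A. (1 - fls_X_intpow (int i)) :: int fls) 2 =
        (\<Prod>i\<in>A. (1 - qhalf (2 * int i)))" if "finite A" for A
      using that by (induction A rule: finite_induct) (simp_all add: qhalf_def)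
    thus ?thesis by (simp add: P_def qpoch_def)
  qed
  ultimately have "qpoch n * fls_compose_power R 2 = 1" by simp
  hence "qpoch n * fls_compose_power R 2 = qpoch n * qpoch_inv n"
    by (simp add: qpoch_mult_inv)
  moreover have "qpoch n \<noteq> 0" using qpoch_mult_inv[of n] by auto
  ultimately have "qpoch_inv n = fls_compose_power R 2" by simp
  thus ?thesis unfolding laurent_q_def by blast
qed

lemma I_Delta_parity: "I_Delta m e \<in> (\<lambda>g. qhalf (e * m) * g) ` laurent_q"
proof -
  have "qpoch_inv_int n \<in> laurent_q" for n
    using qpoch_inv_laurent_q by (auto simp: qpoch_inv_int_def laurent_q_iff)
  hence "qpoch_inv_int n * qpoch_inv_int (n + e) \<in> laurent_q" for n
    by (intro laurent_q_mult)
  hence "fls_nth (I_Delta_summand m e n) k = 0" if "odd (k - e * m)" for n k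
    using that by (auto simp: I_Delta_summand_def qhalf_mult laurent_q_iff)
  hence nth: "fls_nth (I_Delta m e) k = 0" if "odd (k - e * m)" for k
    using that I_Delta_has_sum[of m e] unfolding has_sum_fls_iff by simp
  have "qhalf (- (e * m)) * I_Delta m e \<in> laurent_q"
    unfolding laurent_q_iff
    by (auto simp: qhalf_mult intro!: nth)
  moreover have "I_Delta m e = qhalf (e * m) * (qhalf (- (e * m)) * I_Delta m e)"
    by (simp flip: mult.assoc qhalf_add)
  ultimately show ?thesis by blast
qed

section \<open>The characterization\<close>

lemma V_plus_iff:
  "f \<in> V_plus \<longleftrightarrow> solves_recurrences f \<and>
     (\<forall>m e. f m e \<in> (\<lambda>g. qhalf (e * m) * g) ` laurent_q \<and> vanishes_below 0 (f m e))"
  unfolding V_plus_def solves_recurrences_def power_series_iff_vanishes_below_0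
  by auto

text \<open>The pentagon identity is quadratic on one side and cubic on the other, so a nonzero multiple of a
solution is again a solution only if the factor is 1. The factor is the ratio of \<open>b\<close> and \<open>a\<close>, which need not
exist in \<open>\<int>((q\<^sup>1\<^sup>/\<^sup>2))\<close>; hence the cross-multiplied form.\<close>

lemma pentagon_solution_scale:
  assumes f: "pentagon_identity f" and g: "pentagon_identity g"
    and proportional: "\<And>m e. a * f m e = b * g m e" and "a \<noteq> 0" "b \<noteq> 0" "f 0 0 \<noteq> 0"
  shows "a = b"
proof -
  have F: "((\<lambda>k. qhalf (2 * k) * f 0 k * f 0 k * f 0 k) has_sum f 0 0 * f 0 0) UNIV"
    using f[unfolded pentagon_identity_def, rule_format, of 0 0 0 0] by simp
  have G: "((\<lambda>k. qhalf (2 * k) * g 0 k * g 0 k * g 0 k) has_sum g 0 0 * g 0 0) UNIV"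
    using g[unfolded pentagon_identity_def, rule_format, of 0 0 0 0] by simp
  have cubes: "a ^ 3 * (qhalf (2 * k) * f 0 k * f 0 k * f 0 k) =
      b ^ 3 * (qhalf (2 * k) * g 0 k * g 0 k * g 0 k)" for k
  proof -
    have cubes: "a ^ 3 * (qhalf (2 * k) * f 0 k * f 0 k * f 0 k) = qhalf (2 * k) * (a * f 0 k) ^ 3"
      by (simp add: power3_eq_cube mult_ac)
    also have "\<dots> = b ^ 3 * (qhalf (2 * k) * g 0 k * g 0 k * g 0 k)"
      unfolding proportional by (simp add: power3_eq_cube mult_ac)
    finally show ?thesis .
  qed
  have "a ^ 3 * (f 0 0 * f 0 0) = b ^ 3 * (g 0 0 * g 0 0)"
    using has_sum_cmult_right[OF F, of "a ^ 3"] has_sum_cmult_right[OF G, of "b ^ 3"]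
    unfolding cubes by (rule has_sum_unique)
  hence "a * (a * f 0 0)\<^sup>2 = b * (b * g 0 0)\<^sup>2"
    by (simp add: power2_eq_square power3_eq_cube mult_ac)
  thus "a = b" using assms(4-6) by (simp flip: proportional)
qed

theorem theorem3p7:
  shows "(I_Delta \<in> V_plus \<and> fls_nth (I_Delta 0 0) 0 \<noteq> 0 \<and> pentagon_identity I_Delta) \<and>
         (\<forall>f. f \<in> V_plus \<and> fls_nth (f 0 0) 0 \<noteq> 0 \<and> pentagon_identity f \<longrightarrow> f = I_Delta)"
proof (intro conjI allI impI)
  show "I_Delta \<in> V_plus"
    unfolding V_plus_iff
    using I_Delta_solves_recurrences I_Delta_parity I_Delta_power_series by blast
  show "fls_nth (I_Delta 0 0) 0 \<noteq> 0" by (simp add: I_Delta_0_0_nth_0)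
  show "pentagon_identity I_Delta" by (rule I_Delta_pentagon_identity)
  fix f assume f: "f \<in> V_plus \<and> fls_nth (f 0 0) 0 \<noteq> 0 \<and> pentagon_identity f"
  hence "f 0 0 \<noteq> 0" by auto
  have proportional: "I_Delta 0 0 * f m e = f 0 0 * I_Delta m e" for m e
    by (rule bounded_solutions_proportional[where E = 0])
      (use f I_Delta_solves_recurrences I_Delta_power_series in \<open>auto simp: V_plus_iff\<close>)
  have eq: "I_Delta 0 0 = f 0 0"
    by (rule pentagon_solution_scale[OF _ I_Delta_pentagon_identity proportional])
      (use f I_Delta_0_0_nonzero \<open>f 0 0 \<noteq> 0\<close> in auto)
  show "f = I_Delta"
  proof (intro ext)
    fix m e
    have "f 0 0 * f m e = f 0 0 * I_Delta m e" using proportional[of m e] unfolding eq .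
    thus "f m e = I_Delta m e" using \<open>f 0 0 \<noteq> 0\<close> by simp
  qed
qed

end
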